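(* As $n \to \infty$ through the positive integers, $$\Big(\tfrac{1}{16} - o(1)\Big)\frac{(\log n)^2}{(\log\log n)^2} \;\le\; \dim\big(\mathcal{D}_{[n]}\big) \;\le\; \big(4 + o(1)\big)\frac{(\log n)^2}{\log\log n},$$ where $\mathcal{D}_{[n]}$ is the poset on $[n]=\{1,\dots,n\}$ ordered by divisibility and $\dim$ is the Dushnik–Miller dimension.
   Context: $[n] = \{1,\dots,n\}$, and for $S\subseteq\mathbb{N}$, $\mathcal{D}_S$ denotes the set $S$ partially ordered by divisibility ($a \le b$ iff $a \mid b$). A poset embedding $P \hookrightarrow Q$ is a map $\varphi$ with $\varphi(a)\le_Q\varphi(b)$ if and only if $a\le_P b$. The (Dushnik–Miller) dimension $\dim(P)$ of a countable poset $P$ is the minimum $d$ such that $P$ embeds into $\mathbb{R}^d$ with the product (coordinatewise) order; equivalently, the minimum $d$ such that $P$ embeds into a product of $d$ linear orders. $\log$ is the natural logarithm. Each $o(1)$ denotes a function of $n$ tending to $0$ as $n\to\infty$. *)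

theory Defs
  imports Complex_Main "HOL-Library.FuncSet"
begin

text \<open>A poset is given by a carrier set together with a binary order relation on it.\<close>

definition poset_embedding ::
  "'a set \<Rightarrow> ('a \<Rightarrow> 'a \<Rightarrow> bool) \<Rightarrow> 'b set \<Rightarrow> ('b \<Rightarrow> 'b \<Rightarrow> bool) \<Rightarrow> ('a \<Rightarrow> 'b) \<Rightarrow> bool" where
  "poset_embedding P leP Q leQ \<phi> \<longleftrightarrow>
     \<phi> \<in> P \<rightarrow> Q \<and> (\<forall>a\<in>P. \<forall>b\<in>P. leQ (\<phi> a) (\<phi> b) \<longleftrightarrow> leP a b)"

text \<open>The set of real \<open>d\<close>-tuples, for a variable number \<open>d\<close> of coordinates, encoded as
  functions on the index set \<open>{..<d}\<close>.\<close>

definition real_space :: "nat \<Rightarrow> (nat \<Rightarrow> real) set" where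
  "real_space d = {..<d} \<rightarrow>\<^sub>E UNIV"

definition product_le :: "nat \<Rightarrow> (nat \<Rightarrow> real) \<Rightarrow> (nat \<Rightarrow> real) \<Rightarrow> bool" where
  "product_le d x y \<longleftrightarrow> (\<forall>i<d. x i \<le> y i)"

definition embeds_in_real_space :: "'a set \<Rightarrow> ('a \<Rightarrow> 'a \<Rightarrow> bool) \<Rightarrow> nat \<Rightarrow> bool" where
  "embeds_in_real_space P leP d \<longleftrightarrow>
     (\<exists>\<phi>. poset_embedding P leP (real_space d) (product_le d) \<phi>)"

text \<open>The Dushnik--Miller dimension of a countable poset. The value is meaningful only if the
  poset embeds into some finite power of the reals; the lemma below shows that this is the case
  for every finite poset.\<close>

definition poset_dim :: "'a set \<Rightarrow> ('a \<Rightarrow> 'a \<Rightarrow> bool) \<Rightarrow> nat" where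
  "poset_dim P leP = (LEAST d. embeds_in_real_space P leP d)"

definition divisibility_dim :: "nat set \<Rightarrow> nat" where
  "divisibility_dim S = poset_dim S (dvd)"

lemma finite_poset_embeds_in_real_space:
  assumes "finite P" and refl: "\<And>a. a \<in> P \<Longrightarrow> leP a a"
    and trans: "\<And>a b c. a \<in> P \<Longrightarrow> b \<in> P \<Longrightarrow> c \<in> P \<Longrightarrow> leP a b \<Longrightarrow> leP b c \<Longrightarrow> leP a c"
  shows "\<exists>d. embeds_in_real_space P leP d"
proof -
  obtain xs where xs: "set xs = P" using \<open>finite P\<close> finite_list by blast
  define \<phi> where "\<phi> a = (\<lambda>i\<in>{..<length xs}. if leP (xs ! i) a then 1 else (0::real))" for a
  have le: "product_le (length xs) (\<phi> a) (\<phi> b) \<longleftrightarrow> (\<forall>c\<in>P. leP c a \<longrightarrow> leP c b)" for a b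
    unfolding product_le_def \<phi>_def xs[symmetric] by (auto simp: all_set_conv_all_nth)
  have "poset_embedding P leP (real_space (length xs)) (product_le (length xs)) \<phi>"
    unfolding poset_embedding_def le
    by (intro conjI) (auto simp: real_space_def \<phi>_def intro: refl trans)
  then show ?thesis unfolding embeds_in_real_space_def by blast
qed

end

theory Submission
  imports Defs "HOL-Computational_Algebra.Primes" "HOL-Combinatorics.Permutations"
    "HOL-Real_Asymp.Real_Asymp"
begin

text \<open>
Embeddings of divisibility on \<open>{1..n}\<close> are governed by primes against sets of primes: a coordinate
can tell that the prime \<open>p\<close> does not divide \<open>b\<close> only if it places \<open>p\<close> above \<open>b\<close>, hence above all
prime factors of \<open>b\<close>. Conversely, a linear order of primes that has \<open>p\<close> above all other prime
factors of \<open>b\<close> yields, by comparing exponents lexicographically from the top, a coordinate that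
detects whether \<open>p\<close> has larger multiplicity in \<open>a\<close> than in \<open>b\<close>. Throughout, let \<open>L = ln n\<close>.

Lower bound. All products of \<open>2 * s\<close> primes up to \<open>L\<^sup>2\<close> are at most \<open>n\<close> if \<open>s \<le> L / (4 * ln L)\<close>.
Dushnik's argument (\<open>small_covering_set_exists\<close>) shows that for \<open>s\<^sup>2\<close> points and at most \<open>s\<^sup>2 - s\<close>
linear orders, some point is covered in every order by a set of fewer than \<open>2 * s\<close> others.
Applied to \<open>s\<^sup>2\<close> primes up to \<open>L\<^sup>2\<close>, this excludes a dimension of \<open>s\<^sup>2 - s\<close> or less, and \<open>s\<^sup>2\<close> is
about \<open>L\<^sup>2 / (16 * (ln L)\<^sup>2)\<close>. That there are enough primes follows from
\<open>2 ^ (n - 1) \<le> n ^ \<pi> n\<close>, where \<open>\<pi> n\<close> is the number of primes up to \<open>n\<close>: the left side is a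
lower bound for the least common multiple of \<open>1, \<dots>, n\<close>, and the right side is an upper bound.

Upper bound. Each prime up to \<open>L powr (3 / 2)\<close> gets a coordinate of its own, which costs a lower
order term. The larger primes are divided into ranges \<open>u < ln p \<le> 2 * u\<close> with \<open>u\<close> running through
powers of two times \<open>(3 / 2) * ln L\<close>. A number up to \<open>n\<close> has at most \<open>r = L / u\<close> prime factors in such
a range. A random linear order puts a given prime above \<open>r\<close> others with probability \<open>1 / (r + 1)\<close>,
so about \<open>(r + 1) * ln K\<close> orders handle all pairs of a prime and \<open>r\<close> others, where the number \<open>K\<close> of
these pairs satisfies \<open>ln K \<le> (r + 1) * (2 * u)\<close>. This is about \<open>2 * L\<^sup>2 / u\<close>, and
the geometric sum over all ranges is about \<open>(8 / 3) * L\<^sup>2 / ln L\<close>. Splitting into ranges is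
essential: treated all at once, the large primes would cost a further factor of order \<open>L / ln L\<close>.
\<close>

section \<open>Dimension as the size of a separating family\<close>

text \<open>A product of linear orders that contains the poset is the same thing as a family of monotone
real functions in which every failure of \<open>a \<le> b\<close> is witnessed by one member. Families, as sets,
can be united without any bookkeeping of indices.\<close>

lemma poset_dim_le_card:
  fixes F :: "('a \<Rightarrow> real) set"
  assumes "finite F"
    and mono: "\<And>g a b. g \<in> F \<Longrightarrow> a \<in> P \<Longrightarrow> b \<in> P \<Longrightarrow> leP a b \<Longrightarrow> g a \<le> g b"
    and separating: "\<And>a b. a \<in> P \<Longrightarrow> b \<in> P \<Longrightarrow> \<not> leP a b \<Longrightarrow> \<exists>g\<in>F. g b < g a"
  shows "poset_dim P leP \<le> card F"
proof -
  obtain h where h: "bij_betw h {..<card F} F"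
    using ex_bij_betw_nat_finite[OF \<open>finite F\<close>] by (auto simp: atLeast0LessThan)
  then have F: "F = h ` {..<card F}" by (simp add: bij_betw_def)
  define \<phi> where "\<phi> a = (\<lambda>i\<in>{..<card F}. h i a)" for a
  have "product_le (card F) (\<phi> a) (\<phi> b) \<longleftrightarrow> (\<forall>g\<in>F. g a \<le> g b)" for a b
    unfolding product_le_def \<phi>_def by (subst (2) F) auto
  moreover have "(\<forall>g\<in>F. g a \<le> g b) \<longleftrightarrow> leP a b" if "a \<in> P" "b \<in> P" for a b
    using mono[OF _ that] separating[OF that] by (meson not_le)
  ultimately have "poset_embedding P leP (real_space (card F)) (product_le (card F)) \<phi>"
    unfolding poset_embedding_def by (simp add: real_space_def \<phi>_def)
  then show ?thesis
    unfolding poset_dim_def embeds_in_real_space_def by (intro Least_le) blast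
qed

lemma poset_dim_attained:
  assumes "finite P" and "\<And>a. a \<in> P \<Longrightarrow> leP a a"
    and "\<And>a b c. a \<in> P \<Longrightarrow> b \<in> P \<Longrightarrow> c \<in> P \<Longrightarrow> leP a b \<Longrightarrow> leP b c \<Longrightarrow> leP a c"
  obtains \<phi> :: "'a \<Rightarrow> nat \<Rightarrow> real"
  where "\<And>a b. a \<in> P \<Longrightarrow> b \<in> P \<Longrightarrow> leP a b \<longleftrightarrow> (\<forall>i<poset_dim P leP. \<phi> a i \<le> \<phi> b i)"
proof -
  have "embeds_in_real_space P leP (poset_dim P leP)"
    unfolding poset_dim_def using finite_poset_embeds_in_real_space[OF assms] by (rule LeastI_ex)
  then show thesis
    using that unfolding embeds_in_real_space_def poset_embedding_def product_le_def by metis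
qed

section \<open>Too few coordinates leave a point covered by a small set\<close>

lemma finite_argmax:
  fixes w :: "'a \<Rightarrow> real"
  assumes "finite X" "X \<noteq> {}"
  obtains x where "x \<in> X" "\<And>y. y \<in> X \<Longrightarrow> w y \<le> w x"
proof -
  have "Max (w ` X) \<in> w ` X" using assms by simp
  then obtain x where "x \<in> X" "w x = Max (w ` X)" by auto
  then show thesis using that[of x] assms(1) by simp
qed

text \<open>This is Dushnik's argument for the dimension of the poset of singletons against small subsets.
With \<open>t\<close> coordinates, at most \<open>t\<close> points are chosen as the highest point of some coordinate; let \<open>A\<close>
consist of \<open>s\<close> points that never are. In each coordinate some member of \<open>A\<close> leads \<open>A\<close>, so one
member \<open>a\<close> leads in at most \<open>t / s\<close> coordinates. There the highest point of the coordinate covers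
\<open>a\<close>, and everywhere else the rest of \<open>A\<close> does. The size \<open>s - 1 + t / s\<close> is smallest for \<open>s\<close> near
the square root of \<open>t\<close>.\<close>

lemma small_covering_set_exists:
  fixes w :: "nat \<Rightarrow> 'a \<Rightarrow> real"
  assumes "finite X" and "0 < s" and few: "t + s \<le> card X"
  obtains a R where "a \<in> X" "R \<subseteq> X - {a}" "card R \<le> s - 1 + t div s"
    "\<And>i. i < t \<Longrightarrow> \<exists>b\<in>R. w i a \<le> w i b"
proof -
  have "X \<noteq> {}" using few \<open>0 < s\<close> by auto
  then have "\<exists>x. x \<in> X \<and> (\<forall>y\<in>X. w i y \<le> w i x)" for i
    using finite_argmax[OF \<open>finite X\<close>, of "w i"] by metis
  then obtain top where top: "\<And>i. top i \<in> X" "\<And>i y. y \<in> X \<Longrightarrow> w i y \<le> w i (top i)" by metis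
  have "card (top ` {..<t}) \<le> t" using card_image_le[of "{..<t}" top] by simp
  moreover have "card (X - top ` {..<t}) = card X - card (top ` {..<t})"
    using top(1) \<open>finite X\<close> by (intro card_Diff_subset) auto
  ultimately have "s \<le> card (X - top ` {..<t})" using few by linarith
  then obtain A where A: "A \<subseteq> X - top ` {..<t}" "card A = s" "finite A"
    by (rule obtain_subset_with_card_n)
  have "A \<noteq> {}" using A(2) \<open>0 < s\<close> by auto
  then have "\<exists>x. x \<in> A \<and> (\<forall>y\<in>A. w i y \<le> w i x)" for i
    using finite_argmax[OF A(3), of "w i"] by metis
  then obtain lead where lead: "\<And>i. lead i \<in> A" "\<And>i y. y \<in> A \<Longrightarrow> w i y \<le> w i (lead i)" by metis
  define led where "led a = {i\<in>{..<t}. lead i = a}" for a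
  have "(\<Sum>a\<in>A. card (led a)) = card (\<Union>a\<in>A. led a)"
    using A(3) by (intro card_UN_disjoint[symmetric]) (auto simp: led_def)
  also have "(\<Union>a\<in>A. led a) = {..<t}" using lead(1) by (auto simp: led_def)
  finally have total: "(\<Sum>a\<in>A. card (led a)) = t" by simp
  \<comment> \<open>The member of \<open>A\<close> that leads least often does so at most \<open>t / s\<close> times.\<close>
  have "\<exists>a\<in>A. card (led a) \<le> t div s"
  proof (rule ccontr)
    assume "\<not> ?thesis"
    then have "\<And>a. a \<in> A \<Longrightarrow> Suc (t div s) \<le> card (led a)" by (auto simp: not_le)
    then have "s * Suc (t div s) \<le> t"
      using sum_bounded_below[of A "Suc (t div s)" "\<lambda>a. card (led a)"] total A(2) by simp
    then show False using dividend_less_times_div[OF \<open>0 < s\<close>, of t] by simp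
  qed
  then obtain a where a: "a \<in> A" "card (led a) \<le> t div s" by blast
  define R where "R = (A - {a}) \<union> top ` led a"
  show thesis
  proof (rule that)
    show "a \<in> X" using a(1) A(1) by auto
    have "top i \<noteq> a" if "i < t" for i using that a(1) A(1) by blast
    then show "R \<subseteq> X - {a}" using A(1) top(1) by (auto simp: R_def led_def)
    have "card R \<le> card (A - {a}) + card (top ` led a)" unfolding R_def by (rule card_Un_le)
    also have "\<dots> \<le> (s - 1) + card (led a)"
      using a(1) A by (intro add_mono card_image_le) (auto simp: led_def)
    finally show "card R \<le> s - 1 + t div s" using a(2) by simp
    show "\<exists>b\<in>R. w i a \<le> w i b" if "i < t" for i
    proof (cases "lead i = a")
      case True
      then show ?thesis
        using that top(2)[of a i] a(1) A(1) by (intro bexI[of _ "top i"]) (auto simp: R_def led_def)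
    next
      case False
      then show ?thesis
        using lead a(1) by (intro bexI[of _ "lead i"]) (auto simp: R_def)
    qed
  qed
qed

text \<open>If few coordinates sufficed, then the covering set \<open>R\<close> of primes for the prime \<open>a\<close> would make the
product of \<open>R\<close> at least as high as \<open>a\<close> in every coordinate, although \<open>a\<close> does not divide it. The
size assumption ensures that this product, of fewer than \<open>2 * s\<close> primes, stays below \<open>n\<close>.\<close>

lemma divisibility_dim_gt_of_primes:
  fixes y :: real
  assumes "0 < s" and prime: "\<And>p. p \<in> X \<Longrightarrow> prime p" and "card X = s\<^sup>2" "finite X"
    and le: "\<And>p. p \<in> X \<Longrightarrow> real p \<le> y" and n: "y ^ (2 * s) \<le> real n"
  shows "s\<^sup>2 - s < divisibility_dim {1..n}"
proof (rule ccontr)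
  define t where "t = divisibility_dim {1..n}"
  assume "\<not> ?thesis"
  then have t: "t \<le> s * (s - 1)" by (simp add: t_def power2_eq_square right_diff_distrib')
  obtain \<phi> :: "nat \<Rightarrow> nat \<Rightarrow> real" where \<phi>: "\<And>a b. a \<in> {1..n} \<Longrightarrow> b \<in> {1..n} \<Longrightarrow>
      a dvd b \<longleftrightarrow> (\<forall>i<t. \<phi> a i \<le> \<phi> b i)"
    unfolding t_def divisibility_dim_def
    by (rule poset_dim_attained[of "{1..n}" "(dvd)"]) (auto intro: dvd_trans)
  have "t + s \<le> card X"
    using t \<open>0 < s\<close> \<open>card X = s\<^sup>2\<close> by (cases s) (auto simp: power2_eq_square)
  from small_covering_set_exists[OF \<open>finite X\<close> \<open>0 < s\<close> this, where w = "\<lambda>i x. \<phi> x i"]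
  obtain a R where a: "a \<in> X" and R: "R \<subseteq> X - {a}" "card R \<le> s - 1 + t div s"
    and cover: "\<And>i. i < t \<Longrightarrow> \<exists>b\<in>R. \<phi> a i \<le> \<phi> b i"
    by metis
  have "t div s \<le> s - 1" using div_le_mono[OF t, of s] \<open>0 < s\<close> by simp
  then have card_R: "card R \<le> 2 * s" using R(2) by simp
  have "finite R" using R(1) \<open>finite X\<close> finite_subset by blast
  have y: "1 \<le> y" using le[OF a] prime_ge_1_nat[OF prime[OF a]] by linarith
  have le_n: "x \<in> {1..n}" if "x \<in> X" for x
  proof -
    have "real x \<le> y ^ 1" using le[OF that] by simp
    also have "\<dots> \<le> y ^ (2 * s)" using y \<open>0 < s\<close> by (intro power_increasing) auto
    finally show ?thesis using n prime_ge_1_nat[OF prime[OF that]] by simp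
  qed
  have "real (\<Prod>R) = (\<Prod>p\<in>R. real p)" by simp
  also have "\<dots> \<le> (\<Prod>p\<in>R. y)" using R(1) le by (intro prod_mono) auto
  also have "\<dots> \<le> y ^ (2 * s)" using y card_R by (simp add: power_increasing)
  finally have "\<Prod>R \<le> n" using n by linarith
  moreover have "0 < \<Prod>R" using R(1) prime \<open>finite R\<close> by (auto intro!: prod_pos prime_gt_0_nat)
  ultimately have prod: "\<Prod>R \<in> {1..n}" by (simp add: Suc_le_eq)
  have "\<phi> a i \<le> \<phi> (\<Prod>R) i" if i: "i < t" for i
  proof -
    obtain b where b: "b \<in> R" "\<phi> a i \<le> \<phi> b i" using cover[OF i] by blast
    have "b dvd \<Prod>R" using b(1) \<open>finite R\<close> dvd_prodI[of R b "\<lambda>x. x"] by simp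
    then have "\<phi> b i \<le> \<phi> (\<Prod>R) i" using \<phi>[OF le_n prod] b(1) R(1) i by blast
    then show ?thesis using b(2) by linarith
  qed
  then have "a dvd \<Prod>R" using \<phi>[OF le_n[OF a] prod] by blast
  then obtain b where "b \<in> R" "a dvd b"
    using prime_dvd_prod_iff[of R a "\<lambda>x. x"] \<open>finite R\<close> prime[OF a] by auto
  then show False using R(1) primes_dvd_imp_eq[of a b] prime a by auto
qed

section \<open>A lower bound for the number of primes\<close>

text \<open>The numbers \<open>1 / (n * ((n - 1) choose k))\<close> form the Leibniz harmonic triangle: the first column
is \<open>1 / n\<close>, and each later entry is the difference of two entries of the preceding column, in rows
\<open>n - 1\<close> and \<open>n\<close>. So a number that clears the denominators \<open>1, \<dots>, n\<close> clears all of them. The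
induction step is this recurrence multiplied by \<open>D\<close>.\<close>

lemma mult_binomial_dvd_common_multiple:
  fixes D :: nat
  assumes "k < n" and "\<And>i. 1 \<le> i \<Longrightarrow> i \<le> n \<Longrightarrow> i dvd D"
  shows "n * ((n - 1) choose k) dvd D"
  using assms
proof (induction k arbitrary: n)
  case 0
  then show ?case by simp
next
  case (Suc k)
  obtain m where m: "n = Suc (Suc m)" using Suc.prems(1) by (metis Suc_lessE less_imp_Suc_add add_Suc)
  define x y z where "x = (m choose k)" and "y = (Suc m choose k)" and "z = (Suc m choose Suc k)"
  have "Suc m * x dvd D" "Suc (Suc m) * y dvd D"
    using Suc.IH[of "Suc m"] Suc.IH[of "Suc (Suc m)"] Suc.prems m by (auto simp: x_def y_def)
  then obtain u v where u: "D = Suc m * x * u" and v: "D = Suc (Suc m) * y * v" by (meson dvdE)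
  have xz: "Suc k * z = Suc m * x" unfolding x_def z_def by (rule Suc_times_binomial)
  have kz: "int (Suc m - k) = int (Suc m) - int k" using Suc.prems(1) m by (intro of_nat_diff) simp
  have yz: "Suc k * z = (Suc m - k) * y" unfolding y_def z_def
    using binomial_absorb_comp[of "Suc m" k] Suc_times_binomial[of k m] by simp
  have "int (Suc k) * (int (Suc (Suc m)) * int z * (int u - int v))
      = int (Suc (Suc m)) * int (Suc m * x * u) - (int (Suc m) - int k) * int (Suc (Suc m) * y * v)"
    using arg_cong[OF xz, of int] arg_cong[OF yz, of int] kz by (simp only: of_nat_mult) algebra
  also have "\<dots> = int (Suc k) * int D"
    unfolding u[symmetric] v[symmetric] by (simp add: algebra_simps)
  finally have "int D = int (Suc (Suc m)) * int z * (int u - int v)"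
    by (subst (asm) mult_left_cancel) auto
  then have "int (Suc (Suc m) * z) dvd int D" by (simp only: of_nat_mult dvd_triv_left)
  then have "Suc (Suc m) * z dvd D" by (simp only: of_nat_dvd_iff)
  then show ?case by (simp add: m z_def)
qed

text \<open>Each of the \<open>n\<close> binomial coefficients of row \<open>n - 1\<close> is at most \<open>D / n\<close>, and they add up to
\<open>2 ^ (n - 1)\<close>.\<close>

lemma power_two_le_common_multiple:
  fixes D :: nat
  assumes "0 < n" "0 < D" and "\<And>i. 1 \<le> i \<Longrightarrow> i \<le> n \<Longrightarrow> i dvd D"
  shows "2 ^ (n - 1) \<le> D"
proof -
  have "n * 2 ^ (n - 1) = (\<Sum>k\<le>n - 1. n * ((n - 1) choose k))"
    by (simp add: choose_row_sum flip: sum_distrib_left)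
  also have "\<dots> \<le> (\<Sum>k\<le>n - 1. D)"
    using assms by (intro sum_mono dvd_imp_le mult_binomial_dvd_common_multiple) auto
  also have "\<dots> = n * D" using \<open>0 < n\<close> by simp
  finally show ?thesis using \<open>0 < n\<close> by simp
qed

text \<open>The least common multiple of \<open>1, \<dots>, n\<close> is a product of one prime power, at most \<open>n\<close>, for each
prime up to \<open>n\<close>. This gives a bound of Chebyshev's order of magnitude for the number of primes.\<close>

lemma power_two_le_power_prime_count:
  assumes "0 < n"
  shows "2 ^ (n - 1) \<le> n ^ card {p. prime p \<and> p \<le> n}"
proof -
  define P where "P = {p. prime p \<and> p \<le> n}"
  have "finite P" unfolding P_def by (rule finite_subset[of _ "{..n}"]) auto
  \<comment> \<open>The exponent of \<open>p\<close> in the least common multiple of \<open>1, \<dots>, n\<close>.\<close>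
  define e where "e p = Max (multiplicity p ` {1..n})" for p :: nat
  define D where "D = (\<Prod>p\<in>P. p ^ e p)"
  have e: "p ^ e p \<le> n" for p
  proof -
    have "e p \<in> multiplicity p ` {1..n}" unfolding e_def using \<open>0 < n\<close> by (intro Max_in) auto
    then obtain i where "i \<in> {1..n}" "e p = multiplicity p i" by auto
    then show ?thesis using dvd_imp_le[OF multiplicity_dvd[of p i]] by auto
  qed
  have "i dvd D" if i: "1 \<le> i" "i \<le> n" for i
  proof -
    have "p \<le> n" if "p dvd i" for p using dvd_imp_le[OF that] i by linarith
    then have "prime_factors i \<subseteq> P" by (auto simp: P_def in_prime_factors_iff)
    have "i = (\<Prod>p\<in>prime_factors i. p ^ multiplicity p i)" using i by (simp add: prime_factorization_nat)
    also have "\<dots> dvd D" unfolding D_def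
      using \<open>finite P\<close> \<open>prime_factors i \<subseteq> P\<close> i
      by (intro prod_dvd_prod_subset2 le_imp_power_dvd) (auto simp: e_def)
    finally show ?thesis .
  qed
  moreover have "0 < D" by (auto simp: D_def P_def intro!: prod_pos prime_gt_0_nat)
  ultimately have "2 ^ (n - 1) \<le> D" using \<open>0 < n\<close> by (intro power_two_le_common_multiple)
  also have "\<dots> \<le> (\<Prod>p\<in>P. n)" unfolding D_def using e by (intro prod_mono) auto
  finally show ?thesis by (simp add: P_def)
qed

lemma prime_count_lower_bound:
  assumes "2 \<le> n"
  shows "(real n - 1) * ln 2 / ln (real n) \<le> card {p. prime p \<and> p \<le> n}"
proof -
  have "real (2 ^ (n - 1)) \<le> real (n ^ card {p. prime p \<and> p \<le> n})"
    using power_two_le_power_prime_count[of n] assms by (simp only: of_nat_le_iff)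
  then have "ln (real (2 ^ (n - 1))) \<le> ln (real (n ^ card {p. prime p \<and> p \<le> n}))"
    using assms by (subst ln_le_cancel_iff) auto
  then show ?thesis using assms by (simp add: ln_realpow of_nat_diff divide_simps)
qed

section \<open>Few permutations suffice to lift every point above every small set\<close>

text \<open>Averaging over \<open>U\<close> shows that some \<open>u\<close> hits at least the fraction \<open>1 / m\<close> of what is still
uncovered. Choosing such an element \<open>t\<close> times replaces the choice of \<open>t\<close> random elements.\<close>

lemma greedy_cover:
  fixes hits :: "'x \<Rightarrow> 'u \<Rightarrow> bool"
  assumes "finite U" "U \<noteq> {}" "finite X" "0 < m"
    and frequent: "\<And>x. x \<in> X \<Longrightarrow> card U \<le> m * card {u\<in>U. hits x u}"
  shows "\<exists>T. T \<subseteq> U \<and> card T \<le> t \<and>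
    real (card {x\<in>X. \<forall>u\<in>T. \<not> hits x u}) \<le> (1 - 1 / real m) ^ t * real (card X)"
proof (induction t)
  case 0
  show ?case by (intro exI[of _ "{}"]) auto
next
  case (Suc t)
  then obtain T where T: "T \<subseteq> U" "card T \<le> t"
    and IH: "real (card {x\<in>X. \<forall>u\<in>T. \<not> hits x u}) \<le> (1 - 1 / real m) ^ t * real (card X)" by blast
  define Y where "Y = {x\<in>X. \<forall>u\<in>T. \<not> hits x u}"
  have "finite Y" "Y \<subseteq> X" using \<open>finite X\<close> by (auto simp: Y_def)
  have "card Y * card U = (\<Sum>x\<in>Y. card U)" by simp
  also have "\<dots> \<le> (\<Sum>x\<in>Y. m * card {u\<in>U. hits x u})"
    using \<open>Y \<subseteq> X\<close> frequent by (intro sum_mono) auto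
  also have "\<dots> = m * (\<Sum>u\<in>U. card {x\<in>Y. hits x u})"
    using sum_multicount_gen[of Y U "\<lambda>x u. hits x u" "\<lambda>u. card {x\<in>Y. hits x u}"]
      \<open>finite Y\<close> \<open>finite U\<close> by (simp flip: sum_distrib_left) 
  finally have total: "card Y * card U \<le> (\<Sum>u\<in>U. m * card {x\<in>Y. hits x u})"
    by (simp add: sum_distrib_left)
  have "\<exists>u\<in>U. card Y \<le> m * card {x\<in>Y. hits x u}"
  proof (rule ccontr)
    assume "\<not> ?thesis"
    then have "(\<Sum>u\<in>U. m * card {x\<in>Y. hits x u}) < (\<Sum>u\<in>U. card Y)"
      using \<open>finite U\<close> \<open>U \<noteq> {}\<close> by (intro sum_strict_mono) (auto simp: not_le)
    then show False using total by (simp add: mult.commute)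
  qed
  then obtain u where u: "u \<in> U" "card Y \<le> m * card {x\<in>Y. hits x u}" by blast
  have "real (card Y) \<le> real m * real (card {x\<in>Y. hits x u})"
    using u(2) by (simp flip: of_nat_mult)
  then have gain: "real (card Y) / real m \<le> real (card {x\<in>Y. hits x u})"
    using \<open>0 < m\<close> by (simp add: divide_simps mult.commute)
  have "{x\<in>X. \<forall>v\<in>insert u T. \<not> hits x v} = Y - {x\<in>Y. hits x u}" by (auto simp: Y_def)
  then have "real (card {x\<in>X. \<forall>v\<in>insert u T. \<not> hits x v})
      = real (card Y) - real (card {x\<in>Y. hits x u})"
    using \<open>finite Y\<close> by (simp add: card_Diff_subset of_nat_diff card_mono)
  also have "\<dots> \<le> (1 - 1 / real m) * real (card Y)" using gain by (simp add: algebra_simps)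
  also have "\<dots> \<le> (1 - 1 / real m) * ((1 - 1 / real m) ^ t * real (card X))"
    using IH \<open>0 < m\<close> by (intro mult_left_mono) (auto simp: Y_def)
  finally show ?case
    using T u(1) card_insert_le_m1[of "Suc t" T u]
    by (intro exI[of _ "insert u T"]) (simp add: mult.assoc)
qed

text \<open>As \<open>(1 - 1 / m) ^ t \<le> exp (- t / m)\<close>, fewer than one element is left uncovered.\<close>

lemma cover_exists:
  fixes hits :: "'x \<Rightarrow> 'u \<Rightarrow> bool"
  assumes "finite U" "U \<noteq> {}" "finite X" "0 < m"
    and frequent: "\<And>x. x \<in> X \<Longrightarrow> card U \<le> m * card {u\<in>U. hits x u}"
    and t: "real m * ln (card X) < real t"
  obtains T where "T \<subseteq> U" "card T \<le> t" "\<And>x. x \<in> X \<Longrightarrow> \<exists>u\<in>T. hits x u"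
proof -
  obtain T where "T \<subseteq> U \<and> card T \<le> t \<and>
      real (card {x\<in>X. \<forall>u\<in>T. \<not> hits x u}) \<le> (1 - 1 / real m) ^ t * real (card X)"
    using greedy_cover[where hits = hits and t = t, OF assms(1-5)] ..
  then have T: "T \<subseteq> U" "card T \<le> t"
    and le: "real (card {x\<in>X. \<forall>u\<in>T. \<not> hits x u}) \<le> (1 - 1 / real m) ^ t * real (card X)"
    by simp_all
  have "\<exists>u\<in>T. hits x u" if "x \<in> X" for x
  proof (rule ccontr)
    assume "\<not> ?thesis"
    then have "{x} \<subseteq> {x\<in>X. \<forall>u\<in>T. \<not> hits x u}" using that by auto
    then have "1 \<le> card {x\<in>X. \<forall>u\<in>T. \<not> hits x u}"
      using card_mono[of "{x\<in>X. \<forall>u\<in>T. \<not> hits x u}" "{x}"] \<open>finite X\<close> by simp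
    then have "1 \<le> (1 - 1 / real m) ^ t * real (card X)" using le by linarith
    also have "\<dots> \<le> exp (- 1 / real m) ^ t * real (card X)"
      using exp_ge_add_one_self[of "- 1 / real m"] \<open>0 < m\<close>
      by (intro mult_right_mono power_mono) auto
    also have "\<dots> = exp (real t * (- 1 / real m)) * exp (ln (card X))"
    proof -
      have "0 < card X" using that \<open>finite X\<close> card_gt_0_iff[of X] by auto
      then show ?thesis by (simp only: exp_of_nat_mult[symmetric] exp_ln of_nat_0_less_iff)
    qed
    also have "\<dots> = exp (ln (card X) - real t / real m)" by (simp flip: exp_add)
    also have "\<dots> < 1" using t \<open>0 < m\<close> by (simp add: field_simps)
    finally show False by simp
  qed
  then show thesis by (rule that[OF T])
qed

text \<open>A random permutation puts \<open>p\<close> on top of \<open>S\<close> with probability \<open>1 / card S\<close>: some member of \<open>S\<close> is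
on top, and composition with a transposition shows that all members are equally likely to be.\<close>

lemma card_permutations_le_mult_card_top:
  fixes C :: "'a :: linorder set"
  assumes "finite C" "S \<subseteq> C" "p \<in> S"
  shows "card {f. f permutes C} \<le> card S * card {f. f permutes C \<and> (\<forall>q\<in>S - {p}. f q < f p)}"
proof -
  define W where "W p = {f. f permutes C \<and> (\<forall>q\<in>S - {p}. f q < f p)}" for p
  have "finite S" using assms finite_subset by blast
  have fin: "finite (W q)" for q
    using finite_permutations[OF \<open>finite C\<close>] by (rule finite_subset[rotated]) (auto simp: W_def)
  have swap: "card (W q) \<le> card (W p)" if "q \<in> S" for q
  proof (rule card_inj_on_le)
    let ?\<tau> = "transpose p q"
    show "inj_on (\<lambda>f. f \<circ> ?\<tau>) (W q)"
      by (rule inj_on_inverseI[where g = "\<lambda>f. f \<circ> ?\<tau>"]) (simp add: comp_assoc)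
    have "?\<tau> permutes C" using assms that by (intro permutes_swap_id) auto
    moreover have "?\<tau> r \<in> S - {q}" if "r \<in> S - {p}" for r
      using that \<open>q \<in> S\<close> \<open>p \<in> S\<close> by (auto simp: Transposition.transpose_def)
    ultimately show "(\<lambda>f. f \<circ> ?\<tau>) ` W q \<subseteq> W p"
      by (auto simp: W_def permutes_compose)
  qed (rule fin)
  have "{f. f permutes C} \<subseteq> (\<Union>q\<in>S. W q)"
  proof
    fix f assume "f \<in> {f. f permutes C}"
    then have f: "f permutes C" by simp
    have "Max (f ` S) \<in> f ` S" using \<open>finite S\<close> \<open>p \<in> S\<close> by (intro Max_in) auto
    then obtain q where q: "q \<in> S" "f q = Max (f ` S)" by auto
    have "f r < f q" if "r \<in> S - {q}" for r
    proof -
      have "f r \<le> f q" using that q(2) \<open>finite S\<close> by simp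
      moreover have "f r \<noteq> f q" using that injD[OF permutes_inj[OF f], of r q] by auto
      ultimately show ?thesis by simp
    qed
    then show "f \<in> (\<Union>q\<in>S. W q)" using q(1) f by (auto simp: W_def)
  qed
  then have "card {f. f permutes C} \<le> card (\<Union>q\<in>S. W q)"
    using fin \<open>finite S\<close> by (intro card_mono) auto
  also have "\<dots> \<le> (\<Sum>q\<in>S. card (W q))" using \<open>finite S\<close> by (rule card_UN_le)
  also have "\<dots> \<le> card S * card (W p)" using swap sum_bounded_above[of S "\<lambda>q. card (W q)"] by simp
  finally show ?thesis by (simp add: W_def)
qed

text \<open>There are \<open>card C ^ (r + 1)\<close> pairs of a point and a list of length \<open>r\<close>, and a permutation lifts the
point of a given pair above the list with probability at least \<open>1 / (r + 1)\<close>; the logarithm of the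
number of pairs contributes the second factor \<open>r + 1\<close>. Lists, rather than sets, make the count an
exact power.\<close>

lemma lifting_permutations_exist:
  fixes C :: "'a :: linorder set"
  assumes "finite C" and t: "real (r + 1) ^ 2 * ln (card C) < real t"
  shows "\<exists>T :: ('a \<Rightarrow> 'a) set. finite T \<and> card T \<le> t \<and>
    (\<forall>p R. p \<in> C \<longrightarrow> R \<subseteq> C \<longrightarrow> card R \<le> r \<longrightarrow> (\<exists>f\<in>T. \<forall>q\<in>R - {p}. f q < f p))"
proof -
  define U where "U = {f. f permutes C}"
  define X where "X = C \<times> {xs. set xs \<subseteq> C \<and> length xs = r}"
  define hits where "hits x f \<longleftrightarrow> (\<forall>q\<in>insert (fst x) (set (snd x)) - {fst x}. f q < f (fst x))"
    for x :: "'a \<times> 'a list" and f :: "'a \<Rightarrow> 'a"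
  have "finite U" unfolding U_def by (rule finite_permutations[OF \<open>finite C\<close>])
  have "U \<noteq> {}" unfolding U_def using permutes_id[of C] by blast
  have "finite X" unfolding X_def using \<open>finite C\<close> by (intro finite_cartesian_product finite_lists_length_eq)
  have card_X: "card X = card C ^ (r + 1)"
    unfolding X_def using \<open>finite C\<close> by (simp add: card_cartesian_product card_lists_length_eq)
  have frequent: "card U \<le> (r + 1) * card {f\<in>U. hits x f}" if "x \<in> X" for x
  proof -
    let ?S = "insert (fst x) (set (snd x))"
    have S: "?S \<subseteq> C" "fst x \<in> ?S" using that by (auto simp: X_def)
    have "card ?S \<le> Suc (card (set (snd x)))" by (simp add: card_insert_le_m1)
    also have "\<dots> \<le> r + 1" using card_length[of "snd x"] that by (auto simp: X_def)
    finally have "card ?S \<le> r + 1" .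
    moreover have "card U \<le> card ?S * card {f\<in>U. hits x f}"
      using card_permutations_le_mult_card_top[OF \<open>finite C\<close> S] by (simp add: U_def hits_def)
    ultimately show ?thesis by (meson mult_le_mono1 order_trans)
  qed
  have cost: "real (r + 1) * ln (card X) < real t"
  proof -
    have "ln (card X) = real (r + 1) * ln (card C)"
      unfolding card_X of_nat_power by (rule ln_realpow)
    then show ?thesis using t by (simp only: power2_eq_square mult.assoc)
  qed
  obtain T where T: "T \<subseteq> U" "card T \<le> t" "\<And>x. x \<in> X \<Longrightarrow> \<exists>f\<in>T. hits x f"
    by (rule cover_exists[OF \<open>finite U\<close> \<open>U \<noteq> {}\<close> \<open>finite X\<close> _ frequent cost]) auto
  show ?thesis
  proof (intro exI[of _ T] conjI allI impI)
    show "finite T" using T(1) \<open>finite U\<close> by (rule finite_subset)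
    show "\<exists>f\<in>T. \<forall>q\<in>R - {p}. f q < f p" if pR: "p \<in> C" "R \<subseteq> C" "card R \<le> r" for p R
    proof -
      obtain ys where ys: "set ys = R" "length ys = card R"
        using finite_distinct_list[OF finite_subset[OF pR(2) \<open>finite C\<close>]] distinct_card by metis
      \<comment> \<open>Padding with \<open>p\<close> itself turns \<open>R\<close> into a list of the exact length \<open>r\<close>.\<close>
      define xs where "xs = ys @ replicate (r - card R) p"
      have "(p, xs) \<in> X" using pR ys by (auto simp: X_def xs_def)
      then obtain f where f: "f \<in> T" "hits (p, xs) f" using T(3) by blast
      have "R \<subseteq> set xs" using ys by (auto simp: xs_def)
      then show ?thesis using f by (intro bexI[of _ f]) (auto simp: hits_def)
    qed
  qed (rule T(2))
qed

section \<open>Coordinates from permutations of primes\<close>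

text \<open>A real-valued substitute for the lexicographic order that compares exponents starting where
\<open>f\<close> is largest: the sums are like numbers in base \<open>M\<close>. Digits of \<open>w\<close> above position \<open>f p\<close>
vanish, those below are too small to outweigh a unit at \<open>f p\<close>, and digits of \<open>v\<close> can only help.\<close>

lemma weighted_sum_less_of_leading_digit:
  fixes v w f :: "'a \<Rightarrow> nat"
  assumes "finite C" "p \<in> C" "w p < v p" and M: "(\<Sum>q\<in>C. w q) < M"
    and below: "\<And>q. q \<in> C \<Longrightarrow> q \<noteq> p \<Longrightarrow> 0 < w q \<Longrightarrow> f q < f p"
  shows "(\<Sum>q\<in>C. w q * M ^ f q) < (\<Sum>q\<in>C. v q * M ^ f q)"
proof -
  have "M * (\<Sum>q\<in>C - {p}. w q * M ^ f q) = (\<Sum>q\<in>C - {p}. w q * M ^ Suc (f q))"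
    by (simp add: sum_distrib_left mult.left_commute)
  also have "\<dots> \<le> (\<Sum>q\<in>C - {p}. w q * M ^ f p)"
  proof (rule sum_mono)
    fix q assume "q \<in> C - {p}"
    then show "w q * M ^ Suc (f q) \<le> w q * M ^ f p"
      using below[of q] M power_increasing[of "Suc (f q)" "f p" M] by (cases "w q = 0") auto
  qed
  also have "\<dots> = (\<Sum>q\<in>C - {p}. w q) * M ^ f p" by (simp add: sum_distrib_right)
  also have "\<dots> < M * M ^ f p"
  proof -
    have "(\<Sum>q\<in>C - {p}. w q) \<le> (\<Sum>q\<in>C. w q)" using \<open>finite C\<close> by (intro sum_mono2) auto
    then show ?thesis using M by auto
  qed
  finally have "(\<Sum>q\<in>C - {p}. w q * M ^ f q) < M ^ f p" by simp
  then have "(\<Sum>q\<in>C. w q * M ^ f q) < w p * M ^ f p + M ^ f p"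
    using assms(1,2) by (simp add: sum.remove[of C p])
  also have "\<dots> = Suc (w p) * M ^ f p" by simp
  also have "\<dots> \<le> v p * M ^ f p" using \<open>w p < v p\<close> by (intro mult_right_mono) auto
  also have "\<dots> \<le> (\<Sum>q\<in>C. v q * M ^ f q)" using assms(1,2) by (intro member_le_sum) auto
  finally show ?thesis .
qed

text \<open>Distinct primes dividing \<open>b\<close> have a product of at most \<open>b\<close>, and each is at least \<open>exp u\<close>.\<close>

lemma card_prime_divisors_le:
  fixes b :: nat
  assumes "finite R" "0 < b" "0 < u"
    and R: "\<And>p. p \<in> R \<Longrightarrow> prime p" "\<And>p. p \<in> R \<Longrightarrow> p dvd b" "\<And>p. p \<in> R \<Longrightarrow> u \<le> ln (real p)"
  shows "real (card R) \<le> ln (real b) / u"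
proof -
  have "\<Prod>R dvd (\<Prod>p\<in>prime_factors b. p ^ multiplicity p b)"
  proof (rule prod_dvd_prod_subset2)
    show "R \<subseteq> prime_factors b" using R(1,2) \<open>0 < b\<close> by (auto simp: in_prime_factors_iff)
    show "p dvd p ^ multiplicity p b" if "p \<in> R" for p
      using R(1,2)[OF that] \<open>0 < b\<close> prime_multiplicity_gt_zero_iff[of p b]
      by (auto intro: dvd_power)
  qed simp
  then have "\<Prod>R dvd b" using \<open>0 < b\<close> by (simp flip: prime_factorization_nat)
  then have "\<Prod>R \<le> b" using \<open>0 < b\<close> dvd_imp_le by blast
  have pos: "0 < real p" if "p \<in> R" for p using prime_gt_0_nat[OF R(1)[OF that]] by simp
  have "real (card R) * u = (\<Sum>p\<in>R. u)" by simp
  also have "\<dots> \<le> (\<Sum>p\<in>R. ln (real p))" by (intro sum_mono R(3))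
  also have "\<dots> = ln (\<Prod>p\<in>R. real p)" using pos by (intro ln_prod[symmetric] \<open>finite R\<close>) force
  also have "\<dots> \<le> ln (real b)"
    using \<open>\<Prod>R \<le> b\<close> \<open>0 < b\<close> pos by (subst ln_le_cancel_iff) (auto intro!: prod_pos simp flip: of_nat_prod)
  finally show ?thesis using \<open>0 < u\<close> by (simp add: field_simps)
qed

text \<open>A number up to \<open>n\<close> has at most \<open>r = ln n / u\<close> prime factors larger than \<open>exp u\<close>. If a permutation
lifts \<open>p\<close> above the other prime factors of \<open>b\<close> in the range, then the weighted sum of exponents that
it defines detects every excess of the multiplicity of \<open>p\<close> in \<open>a\<close> over that in \<open>b\<close>. The range has at
most \<open>exp (2 * u)\<close> primes, so \<open>(r + 1)\<^sup>2 * (2 * u) + 1\<close> permutations are enough.\<close>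

lemma coordinates_for_prime_range:
  fixes n :: nat and u :: real
  assumes "0 < n" "0 < u"
  shows "\<exists>F :: (nat \<Rightarrow> real) set. finite F \<and> real (card F) \<le> 2 * u * (ln n / u + 1)\<^sup>2 + 1 \<and>
    (\<forall>g\<in>F. \<forall>a\<in>{1..n}. \<forall>b\<in>{1..n}. a dvd b \<longrightarrow> g a \<le> g b) \<and>
    (\<forall>p. prime p \<longrightarrow> u < ln (real p) \<longrightarrow> ln (real p) \<le> 2 * u \<longrightarrow>
      (\<forall>a\<in>{1..n}. \<forall>b\<in>{1..n}. multiplicity p b < multiplicity p a \<longrightarrow> (\<exists>g\<in>F. g b < g a)))"
proof -
  define C where "C = {p::nat. prime p \<and> u < ln (real p) \<and> ln (real p) \<le> 2 * u}"
  have "C \<subseteq> {1..nat \<lfloor>exp (2 * u)\<rfloor>}"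
  proof
    fix p assume "p \<in> C"
    then have "0 < p" "ln (real p) \<le> 2 * u" by (auto simp: C_def prime_gt_0_nat)
    then have "real p \<le> exp (2 * u)" using exp_le_cancel_iff[of "ln (real p)" "2 * u"] by simp
    then show "p \<in> {1..nat \<lfloor>exp (2 * u)\<rfloor>}" using \<open>0 < p\<close> by (auto simp: le_nat_floor Suc_le_eq)
  qed
  then have "finite C" and "card C \<le> nat \<lfloor>exp (2 * u)\<rfloor>"
    using finite_subset card_mono[of "{1..nat \<lfloor>exp (2 * u)\<rfloor>}" C] by auto
  then have "real (card C) \<le> exp (2 * u)" by (simp add: le_nat_iff le_floor_iff)
  then have ln_card: "ln (card C) \<le> 2 * u"
    using \<open>0 < u\<close> ln_mono[of "real (card C)" "exp (2 * u)"] by (cases "card C = 0") auto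
  define r where "r = nat \<lfloor>ln n / u\<rfloor>"
  define x where "x = 2 * u * (ln n / u + 1)\<^sup>2"
  define t where "t = nat \<lfloor>x\<rfloor> + 1"
  have "0 \<le> ln n / u" using assms by (intro divide_nonneg_pos ln_ge_zero) auto
  then have r: "real r \<le> ln n / u" by (simp add: r_def)
  have "0 \<le> x" using \<open>0 < u\<close> by (simp add: x_def)
  have "real (r + 1) ^ 2 * ln (card C) \<le> real (r + 1) ^ 2 * (2 * u)"
    using ln_card by (intro mult_left_mono) auto
  also have "\<dots> \<le> (ln n / u + 1) ^ 2 * (2 * u)"
    using r \<open>0 < u\<close> by (intro mult_right_mono power_mono) auto
  also have "\<dots> = x" by (simp add: x_def)
  also have "x < real t" using \<open>0 \<le> x\<close> unfolding t_def by linarith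
  finally have cost: "real (r + 1) ^ 2 * ln (card C) < real t" .
  obtain T :: "(nat \<Rightarrow> nat) set" where "finite T \<and> card T \<le> t \<and>
      (\<forall>p R. p \<in> C \<longrightarrow> R \<subseteq> C \<longrightarrow> card R \<le> r \<longrightarrow> (\<exists>f\<in>T. \<forall>q\<in>R - {p}. f q < f p))"
    using lifting_permutations_exist[OF \<open>finite C\<close> cost] ..
  then have T: "finite T" "card T \<le> t"
    and lift: "\<And>p R. p \<in> C \<Longrightarrow> R \<subseteq> C \<Longrightarrow> card R \<le> r \<Longrightarrow> \<exists>f\<in>T. \<forall>q\<in>R - {p}. f q < f p"
    by simp_all
  \<comment> \<open>A base that exceeds every digit sum that occurs.\<close>
  define M where "M = (\<Sum>b\<in>{1..n}. \<Sum>q\<in>C. multiplicity q b) + 1"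
  define g where "g f a = real (\<Sum>q\<in>C. multiplicity q a * M ^ f q)" for f :: "nat \<Rightarrow> nat" and a
  show ?thesis
  proof (intro exI[of _ "g ` T"] conjI ballI allI impI)
    show "finite (g ` T)" using T(1) by simp
    have "card (g ` T) \<le> t" using card_image_le[OF T(1), of g] T(2) by linarith
    then show "real (card (g ` T)) \<le> 2 * u * (ln n / u + 1)\<^sup>2 + 1"
      using \<open>0 \<le> x\<close> unfolding t_def x_def[symmetric] by linarith
  next
    fix h a b assume "h \<in> g ` T" and ab: "a \<in> {1..n}" "b \<in> {1..n}" "a dvd b"
    then obtain f where "h = g f" by blast
    moreover have "multiplicity q a \<le> multiplicity q b" for q
      using ab by (intro dvd_imp_multiplicity_le) auto
    ultimately show "h a \<le> h b" unfolding g_def by (auto intro!: sum_mono simp flip: of_nat_sum)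
  next
    fix p a b
    assume p: "prime p" "u < ln (real p)" "ln (real p) \<le> 2 * u"
      and ab: "a \<in> {1..n}" "b \<in> {1..n}" and less: "multiplicity p b < multiplicity p a"
    have "p \<in> C" using p by (simp add: C_def)
    define R where "R = {q\<in>C. q dvd b}"
    have "real (card R) \<le> ln b / u"
      using ab \<open>finite C\<close> \<open>0 < u\<close> by (intro card_prime_divisors_le) (auto simp: R_def C_def)
    also have "\<dots> \<le> ln n / u" using ab \<open>0 < u\<close> by (intro divide_right_mono) auto
    finally have "card R \<le> r" by (simp add: r_def le_nat_floor)
    then obtain f where f: "f \<in> T" "\<And>q. q \<in> R - {p} \<Longrightarrow> f q < f p"
      using lift[OF \<open>p \<in> C\<close>, of R] by (auto simp: R_def)
    have "(\<Sum>q\<in>C. multiplicity q b) \<le> (\<Sum>b\<in>{1..n}. \<Sum>q\<in>C. multiplicity q b)"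
      using ab by (intro member_le_sum) auto
    then have "(\<Sum>q\<in>C. multiplicity q b) < M" by (simp add: M_def)
    moreover have "f q < f p" if "q \<in> C" "q \<noteq> p" "0 < multiplicity q b" for q
      using that not_dvd_imp_multiplicity_0[of q b] by (intro f(2)) (auto simp: R_def)
    ultimately have "(\<Sum>q\<in>C. multiplicity q b * M ^ f q) < (\<Sum>q\<in>C. multiplicity q a * M ^ f q)"
      using \<open>finite C\<close> \<open>p \<in> C\<close> less
      by (intro weighted_sum_less_of_leading_digit[where p = p]) auto
    then have "g f b < g f a" unfolding g_def by (simp only: of_nat_less_iff)
    then show "\<exists>h\<in>g ` T. h b < h a" using f(1) by blast
  qed
qed

section \<open>The upper bound\<close>

text \<open>Primes up to \<open>exp l\<close> get a coordinate each, their multiplicity. The larger ones are divided into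
ranges in which \<open>ln p\<close> varies by a factor of two: then the coordinates spent on a range, about
\<open>2 * (ln n)\<^sup>2 / u\<close> for the range starting at \<open>u\<close>, decrease geometrically.\<close>

lemma divisibility_dim_le:
  fixes n :: nat and l :: real
  assumes "0 < n" "0 < l" and m: "ln n \<le> 2 ^ m * l"
  shows "real (divisibility_dim {1..n})
    \<le> exp l + (\<Sum>i<m. 2 * (2 ^ i * l) * (ln n / (2 ^ i * l) + 1)\<^sup>2 + 1)"
proof -
  have "\<exists>F :: (nat \<Rightarrow> real) set. finite F \<and> real (card F) \<le> 2 * (2 ^ i * l) * (ln n / (2 ^ i * l) + 1)\<^sup>2 + 1 \<and>
    (\<forall>g\<in>F. \<forall>a\<in>{1..n}. \<forall>b\<in>{1..n}. a dvd b \<longrightarrow> g a \<le> g b) \<and>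
    (\<forall>p. prime p \<longrightarrow> 2 ^ i * l < ln (real p) \<longrightarrow> ln (real p) \<le> 2 * (2 ^ i * l) \<longrightarrow>
      (\<forall>a\<in>{1..n}. \<forall>b\<in>{1..n}. multiplicity p b < multiplicity p a \<longrightarrow> (\<exists>g\<in>F. g b < g a)))"
    (is "\<exists>F. ?good i F") for i :: nat
    using coordinates_for_prime_range[OF \<open>0 < n\<close>, of "2 ^ i * l"] \<open>0 < l\<close> by simp
  then obtain G where G: "\<And>i. ?good i (G i)" by metis
  define S where "S = {p::nat. prime p \<and> ln (real p) \<le> l}"
  define H where "H = (\<lambda>p a. real (multiplicity p a)) ` S"
  have "S \<subseteq> {1..nat \<lfloor>exp l\<rfloor>}"
  proof
    fix p assume "p \<in> S"
    then have "0 < p" "ln (real p) \<le> l" by (auto simp: S_def prime_gt_0_nat)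
    then have "real p \<le> exp l" using exp_le_cancel_iff[of "ln (real p)" l] by simp
    then show "p \<in> {1..nat \<lfloor>exp l\<rfloor>}" using \<open>0 < p\<close> by (auto simp: le_nat_floor Suc_le_eq)
  qed
  then have "finite S" and "card S \<le> nat \<lfloor>exp l\<rfloor>"
    using finite_subset card_mono[of "{1..nat \<lfloor>exp l\<rfloor>}" S] by auto
  then have "real (card S) \<le> exp l" by (simp add: le_nat_iff le_floor_iff)
  then have card_H: "real (card H) \<le> exp l"
    using card_image_le[OF \<open>finite S\<close>, of "\<lambda>p a. real (multiplicity p a)"] by (simp add: H_def)
  have "divisibility_dim {1..n} \<le> card (H \<union> (\<Union>i<m. G i))"
    unfolding divisibility_dim_def
  proof (rule poset_dim_le_card)
    show "finite (H \<union> (\<Union>i<m. G i))" using \<open>finite S\<close> G by (auto simp: H_def)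
  next
    fix g :: "nat \<Rightarrow> real" and a b
    assume g: "g \<in> H \<union> (\<Union>i<m. G i)" and ab: "a \<in> {1..n}" "b \<in> {1..n}" "a dvd b"
    have "multiplicity p a \<le> multiplicity p b" for p
      using ab by (intro dvd_imp_multiplicity_le) auto
    then show "g a \<le> g b" using g G ab by (fastforce simp: H_def)
  next
    fix a b assume ab: "a \<in> {1..n}" "b \<in> {1..n}" "\<not> a dvd b"
    have "\<exists>p. prime p \<and> multiplicity p b < multiplicity p a"
    proof (rule ccontr)
      assume "\<not> ?thesis"
      then have "a dvd b" using ab by (intro multiplicity_le_imp_dvd) (auto simp: not_less)
      then show False using ab by simp
    qed
    then obtain p where p: "prime p" "multiplicity p b < multiplicity p a" by blast
    show "\<exists>g\<in>H \<union> (\<Union>i<m. G i). g b < g a"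
    proof (cases "ln (real p) \<le> l")
      case True
      then have "(\<lambda>a. real (multiplicity p a)) \<in> H" using p(1) by (auto simp: H_def S_def)
      then show ?thesis using p(2) by (intro bexI[of _ "\<lambda>a. real (multiplicity p a)"]) auto
    next
      case False
      have "p dvd a" using p(2) not_dvd_imp_multiplicity_0[of p a] by auto
      then have "p \<le> n" using dvd_imp_le[of p a] ab by auto
      then have "ln (real p) \<le> ln (real n)"
        using prime_gt_0_nat[OF p(1)] by (intro ln_mono) auto
      then have "ln (real p) \<le> 2 ^ m * l" using m by linarith
      \<comment> \<open>The dyadic range of \<open>ln p\<close> ends at the first power of two that reaches it.\<close>
      define j where "j = (LEAST j. ln (real p) \<le> 2 ^ j * l)"
      have j: "ln (real p) \<le> 2 ^ j * l" unfolding j_def by (rule LeastI) fact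
      have "j \<le> m" unfolding j_def by (rule Least_le) fact
      have "j \<noteq> 0" using j False by (cases j) auto
      then obtain i where i: "j = Suc i" by (cases j) auto
      have "\<not> ln (real p) \<le> 2 ^ i * l" using not_less_Least[of i "\<lambda>j. ln (real p) \<le> 2 ^ j * l"] i
        by (simp add: j_def)
      moreover have "ln (real p) \<le> 2 * (2 ^ i * l)" using j i by simp
      ultimately have "\<exists>g\<in>G i. g b < g a" using G[of i] p ab by (simp add: not_le)
      then show ?thesis using \<open>j \<le> m\<close> i by auto
    qed
  qed
  also have "\<dots> \<le> card H + (\<Sum>i<m. card (G i))"
    using card_Un_le[of H] card_UN_le[of "{..<m}" G] by (meson add_left_mono finite_lessThan order_trans)
  finally have "real (divisibility_dim {1..n}) \<le> real (card H) + (\<Sum>i<m. real (card (G i)))"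
    by (simp flip: of_nat_sum of_nat_add)
  also have "\<dots> \<le> exp l + (\<Sum>i<m. 2 * (2 ^ i * l) * (ln n / (2 ^ i * l) + 1)\<^sup>2 + 1)"
    using card_H G by (intro add_mono sum_mono) auto
  finally show ?thesis .
qed

lemma dyadic_cost_sum_le:
  fixes L l :: real
  assumes "1 \<le> l" "1 \<le> L" and below: "\<And>i. i < m \<Longrightarrow> 2 ^ i * l \<le> L"
  shows "(\<Sum>i<m. 2 * (2 ^ i * l) * (L / (2 ^ i * l) + 1)\<^sup>2 + 1) \<le> 4 * L\<^sup>2 / l + 7 * L * real m"
proof -
  have cost: "2 * u * (L / u + 1)\<^sup>2 + 1 \<le> 2 * L\<^sup>2 / u + 7 * L" if "0 < u" "u \<le> L" for u
  proof -
    have "2 * u * (L / u + 1)\<^sup>2 = 2 * L\<^sup>2 / u + 4 * L + 2 * u"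
      using that by (simp add: field_simps power2_eq_square)
    then show ?thesis using that \<open>1 \<le> L\<close> by linarith
  qed
  have "(\<Sum>i<m. 2 * (2 ^ i * l) * (L / (2 ^ i * l) + 1)\<^sup>2 + 1)
      \<le> (\<Sum>i<m. 2 * L\<^sup>2 / (2 ^ i * l) + 7 * L)"
    using below \<open>1 \<le> l\<close> by (intro sum_mono cost) auto
  also have "\<dots> = (\<Sum>i<m. 2 * L\<^sup>2 / l * (1 / 2) ^ i + 7 * L)"
    by (simp add: power_one_over field_simps)
  also have "\<dots> = 2 * L\<^sup>2 / l * (\<Sum>i<m. (1 / 2) ^ i) + 7 * L * real m"
    by (simp only: sum.distrib sum_distrib_left) simp
  also have "(\<Sum>i<m. (1 / 2) ^ i) \<le> (2::real)" by (simp add: sum_gp_strict)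
  then have "2 * L\<^sup>2 / l * (\<Sum>i<m. (1 / 2) ^ i) \<le> 2 * L\<^sup>2 / l * 2"
    using \<open>1 \<le> l\<close> by (intro mult_left_mono) auto
  finally show ?thesis by simp
qed

text \<open>The choice \<open>exp l = (ln n) powr (3 / 2)\<close> makes the number of small primes negligible, and the main
term \<open>4 * (ln n)\<^sup>2 / l\<close> has the constant \<open>8 / 3\<close>. Any exponent strictly between \<open>1\<close> and \<open>2\<close> would
serve for a constant below \<open>4\<close>.\<close>

lemma divisibility_dim_upper_bound:
  assumes n: "exp 2 \<le> ln (real n)"
  shows "real (divisibility_dim {1..n}) \<le> ln n powr (3 / 2)
    + 8 / 3 * ((ln n)\<^sup>2 / ln (ln n)) + 7 * ln n * (log 2 (ln n) + 1)"
proof -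
  define L where "L = ln (real n)"
  define l where "l = 3 / 2 * ln L"
  have "(1::real) \<le> exp 2" by simp
  then have L: "1 \<le> L" using n unfolding L_def by linarith
  then have "0 < n" by (cases n) (auto simp: L_def)
  have "ln (exp 2) \<le> ln L" using n L unfolding L_def by (intro ln_mono) auto
  then have l: "1 \<le> l" by (simp add: l_def)
  \<comment> \<open>The least number of doublings that reach \<open>L\<close>: then every range used starts below \<open>L\<close>.\<close>
  define m where "m = (LEAST m. L \<le> 2 ^ m * l)"
  obtain k :: nat where "L < 2 ^ k" using real_arch_pow[of 2 L] by auto
  moreover have "2 ^ k * 1 \<le> 2 ^ k * l" using l by (intro mult_left_mono) auto
  ultimately have "L \<le> 2 ^ k * l" by linarith
  then have m: "L \<le> 2 ^ m * l" unfolding m_def by (rule LeastI)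
  have below: "2 ^ i * l \<le> L" if "i < m" for i
    using not_less_Least[of i "\<lambda>m. L \<le> 2 ^ m * l"] that unfolding m_def by simp
  have "real m \<le> log 2 L + 1"
  proof (cases m)
    case 0
    then show ?thesis using L by simp
  next
    case (Suc i)
    have "2 ^ i * 1 \<le> 2 ^ i * l" using l by (intro mult_left_mono) auto
    moreover have "2 ^ i * l \<le> L" using Suc by (intro below) simp
    ultimately have "2 ^ i \<le> L" by linarith
    then have "real i \<le> log 2 L" using L by (simp add: le_log_iff powr_realpow)
    then show ?thesis using Suc by simp
  qed
  have "real (divisibility_dim {1..n})
      \<le> exp l + (\<Sum>i<m. 2 * (2 ^ i * l) * (L / (2 ^ i * l) + 1)\<^sup>2 + 1)"
    using divisibility_dim_le[OF \<open>0 < n\<close>, of l m] l m unfolding L_def by simp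
  also have "\<dots> \<le> exp l + (4 * L\<^sup>2 / l + 7 * L * real m)"
    using dyadic_cost_sum_le[OF l L below] by simp
  also have "\<dots> \<le> exp l + (4 * L\<^sup>2 / l + 7 * L * (log 2 L + 1))"
    using \<open>real m \<le> log 2 L + 1\<close> L by (intro add_left_mono mult_left_mono) auto
  also have "exp l = L powr (3 / 2)" using L by (simp add: l_def powr_def)
  also have "4 * L\<^sup>2 / l = 8 / 3 * (L\<^sup>2 / ln L)" by (simp add: l_def)
  finally show ?thesis by (simp add: L_def)
qed

section \<open>The lower bound\<close>

text \<open>With \<open>s\<close> the integer part of \<open>u\<close>, the product of \<open>2 * s\<close> primes up to \<open>L\<^sup>2\<close> is at most
\<open>exp (4 * s * ln L) \<le> exp L = n\<close>. The assumption \<open>many\<close> says that the lower bound for the number of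
primes up to \<open>L\<^sup>2\<close> is at least \<open>u\<^sup>2\<close>, while \<open>s\<^sup>2\<close> primes are needed.\<close>

lemma divisibility_dim_lower_bound:
  assumes L: "L = ln (real n)" "exp 1 \<le> L" and u: "u = L / (4 * ln L)" "1 \<le> u"
    and many: "u\<^sup>2 \<le> (L\<^sup>2 - 2) * ln 2 / (2 * ln L)"
  shows "(u - 1) * (u - 2) \<le> real (divisibility_dim {1..n})"
proof -
  have "(2::real) \<le> exp 1" using exp_ge_add_one_self[of 1] by simp
  then have L2: "2 \<le> L" using L(2) by linarith
  define s where "s = nat \<lfloor>u\<rfloor>"
  have s: "0 < s" "real s \<le> u" "u - 1 < real s" using u(2) by (auto simp: s_def)
  define N where "N = nat \<lfloor>L\<^sup>2\<rfloor>"
  have "2 * 2 \<le> L * L" using L2 by (intro mult_mono) auto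
  then have "4 \<le> L\<^sup>2" by (simp add: power2_eq_square)
  then have N: "2 \<le> N" "real N \<le> L\<^sup>2" "L\<^sup>2 - 1 < real N" unfolding N_def by linarith+
  have ln_N: "ln (real N) \<le> 2 * ln L"
    using ln_mono[of "real N" "L\<^sup>2"] N L2 by (simp add: ln_realpow)
  have "real (s\<^sup>2) \<le> u\<^sup>2" using s by (simp add: power_mono)
  also have "\<dots> \<le> (L\<^sup>2 - 2) * ln 2 / (2 * ln L)" by (rule many)
  also have "\<dots> \<le> (real N - 1) * ln 2 / ln (real N)"
    using N ln_N \<open>4 \<le> L\<^sup>2\<close> by (intro frac_le mult_right_mono mult_nonneg_nonneg ln_gt_zero) auto
  also have "\<dots> \<le> card {p. prime p \<and> p \<le> N}" by (rule prime_count_lower_bound[OF N(1)])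
  finally have "s\<^sup>2 \<le> card {p. prime p \<and> p \<le> N}" by (simp only: of_nat_le_iff)
  then obtain X where X: "X \<subseteq> {p. prime p \<and> p \<le> N}" "card X = s\<^sup>2" "finite X"
    by (rule obtain_subset_with_card_n)
  have "0 < ln L" using L2 by simp
  have "0 < n" using L L2 by (cases n) auto
  have "ln ((L\<^sup>2) ^ (2 * s)) = 4 * real s * ln L" using L2 by (simp add: ln_realpow)
  also have "\<dots> \<le> 4 * u * ln L" using s \<open>0 < ln L\<close> by (intro mult_right_mono) auto
  also have "\<dots> = ln (real n)" using \<open>0 < ln L\<close> by (simp add: u L(1)[symmetric])
  finally have "(L\<^sup>2) ^ (2 * s) \<le> real n" using \<open>0 < n\<close> L2 by (subst (asm) ln_le_cancel_iff) auto
  moreover have "real p \<le> L\<^sup>2" if "p \<in> X" for p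
  proof -
    have "real p \<le> real N" using that X(1) by auto
    then show ?thesis using N(2) by linarith
  qed
  ultimately have "s\<^sup>2 - s < divisibility_dim {1..n}"
    using X s(1) by (intro divisibility_dim_gt_of_primes[where X = X and y = "L\<^sup>2"]) auto
  moreover have "s \<le> s\<^sup>2" using s(1) by (simp add: power2_eq_square)
  ultimately have "(real s)\<^sup>2 - real s \<le> real (divisibility_dim {1..n})"
    by (metis less_imp_le of_nat_diff of_nat_le_iff of_nat_power)
  moreover have "(u - 1) * (u - 2) \<le> real s * (real s - 1)"
  proof (cases "2 \<le> u")
    case True
    then show ?thesis using s by (intro mult_mono) auto
  next
    case False
    then have "(u - 1) * (u - 2) \<le> 0" using u(2) by (intro mult_nonneg_nonpos) auto
    moreover have "0 \<le> real s * (real s - 1)" using s(1) by (intro mult_nonneg_nonneg) auto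
    ultimately show ?thesis by linarith
  qed
  ultimately show ?thesis by (simp add: power2_eq_square algebra_simps)
qed

section \<open>The asymptotic bounds\<close>

theorem theorem1p1:
  "\<exists>\<epsilon> \<delta> :: nat \<Rightarrow> real. \<epsilon> \<longlonglongrightarrow> 0 \<and> \<delta> \<longlonglongrightarrow> 0 \<and>
     (\<forall>\<^sub>F n in sequentially.
        (1 / 16 - \<epsilon> n) * ((ln (real n))\<^sup>2 / (ln (ln (real n)))\<^sup>2) \<le> real (divisibility_dim {1..n}) \<and>
        real (divisibility_dim {1..n}) \<le> (4 + \<delta> n) * ((ln (real n))\<^sup>2 / ln (ln (real n))))"
proof (intro exI conjI)
  \<comment> \<open>For \<open>u = ln n / (4 * ln (ln n))\<close>, this turns the main term \<open>u\<^sup>2\<close> into \<open>u\<^sup>2 - 3 * u\<close>.\<close>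
  let ?\<epsilon> = "\<lambda>n. 3 / 4 * (ln (ln (real n)) / ln (real n))"
  show "?\<epsilon> \<longlonglongrightarrow> 0" by real_asymp
  \<comment> \<open>The constant \<open>8 / 3\<close> of the upper bound leaves room for all lower order terms.\<close>
  show "(\<lambda>n. 0 :: real) \<longlonglongrightarrow> 0" by simp
  have "\<forall>\<^sub>F n in sequentially. exp 2 \<le> ln (real n)" by real_asymp
  moreover have "\<forall>\<^sub>F n in sequentially. 1 \<le> ln (real n) / (4 * ln (ln (real n)))" by real_asymp
  moreover have "\<forall>\<^sub>F n in sequentially. (ln (real n) / (4 * ln (ln (real n))))\<^sup>2
      \<le> ((ln (real n))\<^sup>2 - 2) * ln 2 / (2 * ln (ln (real n)))" by real_asymp
  moreover have "\<forall>\<^sub>F n in sequentially. ln n powr (3 / 2) + 8 / 3 * ((ln n)\<^sup>2 / ln (ln n))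
      + 7 * ln n * (log 2 (ln n) + 1) \<le> (4 + 0) * ((ln (real n))\<^sup>2 / ln (ln (real n)))" by real_asymp
  ultimately show "\<forall>\<^sub>F n in sequentially.
      (1 / 16 - ?\<epsilon> n) * ((ln (real n))\<^sup>2 / (ln (ln (real n)))\<^sup>2) \<le> real (divisibility_dim {1..n}) \<and>
      real (divisibility_dim {1..n}) \<le> (4 + 0) * ((ln (real n))\<^sup>2 / ln (ln (real n)))"
  proof eventually_elim
    case (elim n)
    define L where "L = ln (real n)"
    define u where "u = L / (4 * ln L)"
    have "exp 1 \<le> exp (2::real)" by simp
    then have "exp 1 \<le> L" using elim(1) unfolding L_def by linarith
    then have "1 < L" using exp_gt_one[of 1] by linarith
    have "(1 / 16 - 3 / 4 * (ln L / L)) * (L\<^sup>2 / (ln L)\<^sup>2) = u\<^sup>2 - 3 * u"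
      using \<open>1 < L\<close> ln_gt_zero[OF \<open>1 < L\<close>] by (simp add: u_def field_simps power2_eq_square)
    also have "\<dots> \<le> (u - 1) * (u - 2)" by (simp add: power2_eq_square algebra_simps)
    also have "\<dots> \<le> real (divisibility_dim {1..n})"
      using elim(2,3) \<open>exp 1 \<le> L\<close>
      by (intro divisibility_dim_lower_bound[OF L_def _ u_def]) (simp_all add: L_def u_def)
    finally show ?case
      using divisibility_dim_upper_bound[OF elim(1)] elim(4) unfolding L_def by linarith
  qed
qed

end
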